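(* Let $q$ be a prime power and let $\ell\ge0$ be a fixed integer. Let $n$ and $k$ range over nonnegative integers with $\ell\leq k\leq 2n$ and $k=2k_0+\ell$ for a nonnegative integer $k_0$. Then $$\lim_{\substack{k\rightarrow \infty \\ (2n-k)\rightarrow\infty}}\frac{|{\rm SHull}[2n,k]_q^\ell|}{\begin{bmatrix} 2n \\ k \end{bmatrix}_q}=\frac{q^{\ell}\cdot g_{q,\infty}}{h_{q,\ell}\cdot g_{q^2,\infty}}.$$ In particular, if $\ell=0$, then $$\lim_{\substack{k\rightarrow \infty \\ (2n-k)\rightarrow\infty}}\frac{|{\rm SHull}[2n,k]^0_q|}{\begin{bmatrix} 2n \\ k \end{bmatrix}_q}=\lim_{\substack{k_0\rightarrow \infty \\ (n-k_0)\rightarrow\infty}}\frac{|{\rm SLCD}[2n,2k_0]_q|}{\begin{bmatrix} 2n \\ 2k_0 \end{bmatrix}_q}=\frac{g_{q,\infty}}{g_{q^2,\infty}}.$$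
   Context: A linear $[m,k]_q$ code is a $k$-dimensional subspace of $\mathbb{F}_q^m$. On $\mathbb{F}_q^{2n}$ the symplectic inner product is $\langle \mathbf{x},\mathbf{y}\rangle_{\rm s}=\sum_{i=1}^n(x_iy_{n+i}-x_{n+i}y_i)$. For a code $C\subseteq\mathbb{F}_q^{2n}$, $C^{\perp_{\rm s}}=\{\mathbf{y}\in\mathbb{F}_q^{2n} : \langle\mathbf{x},\mathbf{y}\rangle_{\rm s}=0\text{ for all }\mathbf{x}\in C\}$, and its symplectic hull is ${\rm Hull_s}(C)=C\cap C^{\perp_{\rm s}}$; $C$ is symplectic LCD if this hull is $\{\mathbf{0}\}$. ${\rm SHull}[2n,k]_q^{\ell}$ denotes the set of all linear $[2n,k]_q$ codes whose symplectic hull has dimension $\ell$, and ${\rm SLCD}[2n,2k_0]_q$ the set of all symplectic LCD $[2n,2k_0]_q$ codes. For real $Q>1$: $\begin{bmatrix} n\\k\end{bmatrix}_Q=\frac{(Q^n-1)(Q^n-Q)\cdots(Q^n-Q^{k-1})}{(Q^k-1)(Q^k-Q)\cdots(Q^k-Q^{k-1})}$ for $k\ne0$ and $\begin{bmatrix} n\\0\end{bmatrix}_Q=1$; $g_{Q,n}=\prod_{i=1}^n\left(1-\frac{1}{Q^i}\right)$ and $g_{Q,\infty}=\lim_{n\to\infty}g_{Q,n}$ (a positive limit); $h_{Q,\ell}=\prod_{i=1}^{\ell}(Q^i-1)$, with $h_{Q,0}=1$. The first limit means: for every $\varepsilon>0$ there is $M$ such that the quotient is within $\varepsilon$ of the stated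 value for all admissible $(n,k)$ (with $k\equiv\ell \bmod 2$) satisfying $k\ge M$ and $2n-k\ge M$; the limit in $k_0$, $n-k_0$ is understood analogously. *)

theory Defs
  imports
    "Jordan_Normal_Form.VS_Connect"
    "HOL-Number_Theory.Prime_Powers"
begin

text \<open>
  The field with \<open>q\<close> elements is a type of classes \<^class>\<open>field\<close> and \<^class>\<open>finite\<close> whose
  cardinality is \<open>q\<close>. Vectors of length \<open>m\<close> over it are the elements of \<^term>\<open>carrier_vec m\<close>;
  coordinates are numbered from 0, so the coordinate \<open>x\<^sub>i\<close> of the usual
  one-based notation is \<open>x $ (i - 1)\<close>.
\<close>

definition vdim :: "nat \<Rightarrow> 'a :: field vec set \<Rightarrow> nat" where
  "vdim m W = vectorspace.dim class_ring (module_vec TYPE('a) m \<lparr>carrier := W\<rparr>)"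

definition linear_codes :: "nat \<Rightarrow> nat \<Rightarrow> 'a :: field vec set set" where
  "linear_codes m k = {C. VectorSpace.subspace class_ring C (module_vec TYPE('a) m) \<and> vdim m C = k}"

definition symp_inner :: "nat \<Rightarrow> 'a :: field vec \<Rightarrow> 'a vec \<Rightarrow> 'a" where
  "symp_inner n x y = (\<Sum>i<n. x $ i * y $ (n + i) - x $ (n + i) * y $ i)"

definition symp_dual :: "nat \<Rightarrow> 'a :: field vec set \<Rightarrow> 'a vec set" where
  "symp_dual n C = {y \<in> carrier_vec (2 * n). \<forall>x\<in>C. symp_inner n x y = 0}"

definition symp_hull :: "nat \<Rightarrow> 'a :: field vec set \<Rightarrow> 'a vec set" where
  "symp_hull n C = C \<inter> symp_dual n C"

definition symp_LCD :: "nat \<Rightarrow> 'a :: field vec set \<Rightarrow> bool" where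
  "symp_LCD n C \<longleftrightarrow> symp_hull n C = {0\<^sub>v (2 * n)}"

text \<open>In \<open>SHull\<close> and \<open>SLCD\<close> the first argument is \<open>n\<close>; the length of the codes is \<open>2 * n\<close>.\<close>

definition SHull :: "nat \<Rightarrow> nat \<Rightarrow> nat \<Rightarrow> 'a :: field vec set set" where
  "SHull n k l = {C \<in> linear_codes (2 * n) k. vdim (2 * n) (symp_hull n C) = l}"

definition SLCD :: "nat \<Rightarrow> nat \<Rightarrow> 'a :: field vec set set" where
  "SLCD n k = {C \<in> linear_codes (2 * n) k. symp_LCD n C}"

definition gauss_binomial :: "real \<Rightarrow> nat \<Rightarrow> nat \<Rightarrow> real" where
  "gauss_binomial Q n k = (\<Prod>i<k. Q ^ n - Q ^ i) / (\<Prod>i<k. Q ^ k - Q ^ i)"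

definition g_fin :: "real \<Rightarrow> nat \<Rightarrow> real" where
  "g_fin Q n = (\<Prod>i=1..n. 1 - 1 / Q ^ i)"

definition g_inf :: "real \<Rightarrow> real" where
  "g_inf Q = lim (g_fin Q)"

definition h_prod :: "real \<Rightarrow> nat \<Rightarrow> real" where
  "h_prod Q l = (\<Prod>i=1..l. Q ^ i - 1)"

end

theory Submission
  imports Defs "HOL-Library.Cardinality"
begin

text \<open>
  Build a code by adding one vector at a time. If \<open>C\<close> has hull \<open>R\<close> and \<open>v \<notin> C\<close>, then the
  hull of \<open>C + \<langle>v\<rangle>\<close> has dimension one more than \<open>R\<close> if \<open>v \<in> R\<^sup>\<bottom>\<close>, and one less
  otherwise. As \<open>R\<^sup>\<bottom>\<close> has \<open>q ^ (2 * n - dim R)\<close> elements, the number of independent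
  \<open>k\<close>-tuples whose span has hull dimension \<open>r\<close> satisfies a two-term recurrence in \<open>k\<close>, which
  has a closed product solution. Every code of dimension \<open>k\<close> is spanned by the same number of
  independent \<open>k\<close>-tuples, so dividing by the Gaussian binomial turns the solution into
  \<open>q ^ l / h\<^sub>l\<close> times a quotient of finite products \<open>g\<close>, each of which converges.
\<close>

subsection \<open>Subspaces and their cardinalities\<close>

text \<open>Bare closure conditions in place of the locale-based \<open>subspace\<close>, so that
  membership goals can be solved by simplification; \<open>subspace_iff_vec_subspace\<close>
  translates.\<close>

definition vec_subspace :: "nat \<Rightarrow> 'a :: field vec set \<Rightarrow> bool" where
  "vec_subspace m W \<longleftrightarrow> W \<subseteq> carrier_vec m \<and> 0\<^sub>v m \<in> W \<and>
     (\<forall>x\<in>W. \<forall>y\<in>W. x + y \<in> W) \<and> (\<forall>a. \<forall>x\<in>W. a \<cdot>\<^sub>v x \<in> W)"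

lemma vec_subspaceD:
  assumes "vec_subspace m W"
  shows "W \<subseteq> carrier_vec m" "x \<in> W \<Longrightarrow> x \<in> carrier_vec m" "0\<^sub>v m \<in> W"
    "x \<in> W \<Longrightarrow> y \<in> W \<Longrightarrow> x + y \<in> W" "x \<in> W \<Longrightarrow> a \<cdot>\<^sub>v x \<in> W"
  using assms by (auto simp: vec_subspace_def)

lemma vec_subspace_diff:
  assumes W: "vec_subspace m W" and "x \<in> W" "y \<in> W"
  shows "x - y \<in> W"
proof -
  have "x - y = x + (-1) \<cdot>\<^sub>v y"
    using assms by (intro eq_vecI) (auto dest!: vec_subspaceD(2)[OF W])
  then show ?thesis
    using assms by (simp add: vec_subspaceD)
qed

lemma vec_subspace_carrier [simp]: "vec_subspace m (carrier_vec m)"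
  by (auto simp: vec_subspace_def)

lemma vec_subspace_zero [simp]: "vec_subspace m {0\<^sub>v m}"
  by (auto simp: vec_subspace_def)

lemma vec_subspace_Int: "vec_subspace m A \<Longrightarrow> vec_subspace m B \<Longrightarrow> vec_subspace m (A \<inter> B)"
  by (auto simp: vec_subspace_def)

lemma subspace_iff_vec_subspace:
  "VectorSpace.subspace class_ring W (module_vec TYPE('a::field) m) \<longleftrightarrow> vec_subspace m W"
proof -
  interpret vec_space "TYPE('a)" m .
  show ?thesis
  proof
    assume "VectorSpace.subspace class_ring W V"
    then have "submodule class_ring W V"
      by (simp add: VectorSpace.subspace_def)
    then show "vec_subspace m W"
      by (auto simp: vec_subspace_def submodule_def module_vec_simps)
  next
    assume W: "vec_subspace m W"
    have "submodule class_ring W V"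
      using W module_axioms by (auto simp: submodule_def vec_subspace_def module_vec_simps)
    then show "VectorSpace.subspace class_ring W V"
      by (auto simp: VectorSpace.subspace_def intro: vectorspace_axioms)
  qed
qed

lemma finite_carrier_vec [simp]: "finite (carrier_vec m :: 'a::finite vec set)"
proof -
  have "carrier_vec m \<subseteq> vec_of_list ` {xs :: 'a list. set xs \<subseteq> UNIV \<and> length xs = m}"
  proof
    fix v :: "'a vec" assume "v \<in> carrier_vec m"
    then show "v \<in> vec_of_list ` {xs :: 'a list. set xs \<subseteq> UNIV \<and> length xs = m}"
      by (intro image_eqI[of _ _ "list_of_vec v"]) (auto simp: vec_list)
  qed
  then show ?thesis
    by (rule finite_subset) (intro finite_imageI finite_lists_length_eq, simp)
qed

lemma finite_vec_subspace: "vec_subspace m (W :: 'a::{field,finite} vec set) \<Longrightarrow> finite W"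
  using finite_subset[OF vec_subspaceD(1) finite_carrier_vec] .

text \<open>Coordinates with respect to a basis \<open>B\<close> identify \<open>W\<close> with the
  functions from \<open>B\<close> to the field. From here on dimensions are handled as
  cardinalities.\<close>

lemma card_eq_power_vdim:
  assumes W: "vec_subspace m (W :: 'a::{field,finite} vec set)"
  shows "card W = CARD('a) ^ vdim m W"
proof -
  interpret V: vec_space "TYPE('a)" m .
  have sub: "VectorSpace.subspace class_ring W V.V"
    using W by (simp add: subspace_iff_vec_subspace)
  interpret W: vectorspace class_ring "V.vs W"
    by (rule V.subspace_is_vs[OF sub])
  have "W.gen_set W"
    using W.span_is_subset2 W.in_own_span by auto
  then have "W.fin_dim"
    using finite_vec_subspace[OF W] by (auto simp: W.fin_dim_def)
  then obtain B where B: "finite B" "W.basis B"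
    using W.finite_basis_exists by blast
  then have BW: "B \<subseteq> carrier (V.vs W)"
    by (simp add: W.basis_def)
  have ex: "\<forall>v. v \<in> W \<longrightarrow> (\<exists>!a. a \<in> B \<rightarrow>\<^sub>E UNIV \<and> W.lincomb a B = v)"
    using W.basis_criterion[OF B(1) BW] B(2) by simp
  have "bij_betw (\<lambda>a. W.lincomb a B) (B \<rightarrow>\<^sub>E UNIV) W"
  proof (rule bij_betwI')
    fix a b :: "'a vec \<Rightarrow> 'a" assume ab: "a \<in> B \<rightarrow>\<^sub>E UNIV" "b \<in> B \<rightarrow>\<^sub>E UNIV"
    have "W.lincomb b B \<in> W"
      using W.lincomb_closed[OF BW, of b] by simp
    then show "W.lincomb a B = W.lincomb b B \<longleftrightarrow> a = b"
      using ex ab by blast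
  next
    fix a :: "'a vec \<Rightarrow> 'a" assume "a \<in> B \<rightarrow>\<^sub>E UNIV"
    show "W.lincomb a B \<in> W"
      using W.lincomb_closed[OF BW, of a] by simp
  next
    fix v assume "v \<in> W"
    then show "\<exists>a\<in>B \<rightarrow>\<^sub>E UNIV. v = W.lincomb a B"
      using ex by metis
  qed
  then have "card W = card (B \<rightarrow>\<^sub>E (UNIV :: 'a set))"
    by (simp add: bij_betw_same_card)
  also have "\<dots> = CARD('a) ^ card B"
    using B by (simp add: card_PiE)
  also have "card B = vdim m W"
    using W.dim_basis[OF B] by (simp add: vdim_def)
  finally show ?thesis .
qed

lemma card_carrier_vec: "card (carrier_vec m :: 'a::{field,finite} vec set) = CARD('a) ^ m"
proof -
  interpret vec_space "TYPE('a)" m .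
  have "vdim m (carrier_vec m :: 'a vec set) = m"
    using dim_is_n by (simp add: vdim_def module_vec_def)
  then show ?thesis
    using card_eq_power_vdim[OF vec_subspace_carrier, where 'a = 'a and m = m] by simp
qed

section \<open>Enlarging a subspace by one vector, and kernels of linear functionals\<close>

definition adjoin :: "'a :: field vec set \<Rightarrow> 'a vec \<Rightarrow> 'a vec set" where
  "adjoin W v = (\<lambda>(x, a). x + a \<cdot>\<^sub>v v) ` (W \<times> UNIV)"

lemma adjoin_subspace:
  assumes W: "vec_subspace m W" and v: "v \<in> carrier_vec m"
  shows "vec_subspace m (adjoin W v)"
  unfolding vec_subspace_def
proof (intro conjI ballI allI)
  show "adjoin W v \<subseteq> carrier_vec m"
    using v by (auto simp: adjoin_def dest: vec_subspaceD(2)[OF W])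
  show "0\<^sub>v m \<in> adjoin W v"
    using vec_subspaceD(3)[OF W] v unfolding adjoin_def
    by (intro image_eqI[of _ _ "(0\<^sub>v m, 0)"]) auto
next
  fix x y assume "x \<in> adjoin W v" "y \<in> adjoin W v"
  then obtain x' a y' b where *: "x' \<in> W" "y' \<in> W" "x = x' + a \<cdot>\<^sub>v v" "y = y' + b \<cdot>\<^sub>v v"
    by (auto simp: adjoin_def)
  have "x + y = (x' + y') + (a + b) \<cdot>\<^sub>v v"
    using * v by (intro eq_vecI) (auto simp: algebra_simps dest!: vec_subspaceD(2)[OF W])
  then show "x + y \<in> adjoin W v"
    using vec_subspaceD(4)[OF W *(1,2)] by (auto simp: adjoin_def)
next
  fix c x assume "x \<in> adjoin W v"
  then obtain x' a where *: "x' \<in> W" "x = x' + a \<cdot>\<^sub>v v"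
    by (auto simp: adjoin_def)
  have "c \<cdot>\<^sub>v x = c \<cdot>\<^sub>v x' + (c * a) \<cdot>\<^sub>v v"
    using * v by (intro eq_vecI) (auto simp: algebra_simps dest!: vec_subspaceD(2)[OF W])
  then show "c \<cdot>\<^sub>v x \<in> adjoin W v"
    using vec_subspaceD(5)[OF W *(1)] by (auto simp: adjoin_def)
qed

lemma subset_adjoin:
  assumes W: "vec_subspace m W" and v: "v \<in> carrier_vec m"
  shows "W \<subseteq> adjoin W v"
proof
  fix x assume x: "x \<in> W"
  then have "x = x + 0 \<cdot>\<^sub>v v"
    using v by (intro eq_vecI) (auto dest!: vec_subspaceD(2)[OF W])
  then show "x \<in> adjoin W v"
    unfolding adjoin_def by (intro image_eqI[of _ _ "(x, 0)"]) (use x in auto)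
qed

lemma in_adjoin:
  assumes W: "vec_subspace m W" and v: "v \<in> carrier_vec m"
  shows "v \<in> adjoin W v"
  using vec_subspaceD(3)[OF W] v unfolding adjoin_def
  by (intro image_eqI[of _ _ "(0\<^sub>v m, 1)"]) auto

lemma adjoin_minimal:
  assumes "vec_subspace m U" "W \<subseteq> U" "v \<in> U"
  shows "adjoin W v \<subseteq> U"
proof
  fix x assume "x \<in> adjoin W v"
  then obtain y a where "y \<in> W" "x = y + a \<cdot>\<^sub>v v"
    by (auto simp: adjoin_def)
  then show "x \<in> U"
    using assms vec_subspaceD(4,5)[OF assms(1)] by blast
qed

text \<open>The parametrisation by pairs \<open>(x, a)\<close> is injective: two representations
  with different coefficients of \<open>v\<close> could be solved for \<open>v\<close>, which would
  then lie in \<open>W\<close>.\<close>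

lemma card_adjoin:
  fixes W :: "'a::{field,finite} vec set"
  assumes W: "vec_subspace m W" and v: "v \<in> carrier_vec m" "v \<notin> W"
  shows "card (adjoin W v) = CARD('a) * card W"
proof -
  have "inj_on (\<lambda>(x, a). x + a \<cdot>\<^sub>v v) (W \<times> UNIV)"
  proof (rule inj_onI, clarify)
    fix x a y b assume x: "x \<in> W" and y: "y \<in> W" and eq: "x + a \<cdot>\<^sub>v v = y + b \<cdot>\<^sub>v v"
    have xc: "x \<in> carrier_vec m" "y \<in> carrier_vec m"
      using x y by (auto dest: vec_subspaceD(2)[OF W])
    have comp: "x $ i + a * v $ i = y $ i + b * v $ i" if "i < m" for i
      using arg_cong[OF eq, of "\<lambda>u. u $ i"] xc v that by simp
    have ab: "a = b"
    proof (rule ccontr)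
      assume "a \<noteq> b"
      have "v = inverse (a - b) \<cdot>\<^sub>v (y - x)"
      proof (rule eq_vecI)
        fix i assume "i < dim_vec (inverse (a - b) \<cdot>\<^sub>v (y - x))"
        then have i: "i < m" using xc by simp
        then have "(a - b) * v $ i = y $ i - x $ i"
          using comp[OF i] by (simp add: algebra_simps)
        then show "v $ i = (inverse (a - b) \<cdot>\<^sub>v (y - x)) $ i"
          using xc i \<open>a \<noteq> b\<close> by (simp add: divide_simps mult.commute)
      qed (use xc v in auto)
      then show False
        using v vec_subspaceD(5)[OF W vec_subspace_diff[OF W y x]] by metis
    qed
    moreover have "x = y"
      using comp xc ab by (intro eq_vecI) auto
    ultimately show "x = y \<and> a = b" by simp
  qed
  then show ?thesis
    by (simp add: adjoin_def card_image card_cartesian_product)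
qed

text \<open>A functional that is nonzero at \<open>v\<close> splits \<open>W\<close> into its kernel
  and the line through \<open>v\<close>, so adjoining \<open>v\<close> to the kernel recovers all of
  \<open>W\<close>.\<close>

lemma card_eq_card_kernel:
  fixes W :: "'a::{field,finite} vec set" and f :: "'a vec \<Rightarrow> 'a"
  assumes W: "vec_subspace m W"
    and add: "\<And>x y. x \<in> W \<Longrightarrow> y \<in> W \<Longrightarrow> f (x + y) = f x + f y"
    and smult: "\<And>a x. x \<in> W \<Longrightarrow> f (a \<cdot>\<^sub>v x) = a * f x"
    and v: "v \<in> W" "f v \<noteq> 0"
  shows "card W = CARD('a) * card {x \<in> W. f x = 0}"
proof -
  let ?K = "{x \<in> W. f x = 0}"
  have f0: "f (0\<^sub>v m) = 0"
  proof -
    have "0 \<cdot>\<^sub>v v = 0\<^sub>v m"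
      using vec_subspaceD(2)[OF W v(1)] by (intro eq_vecI) auto
    then show ?thesis
      using smult[OF v(1), of 0] by simp
  qed
  have K: "vec_subspace m ?K"
    using W f0 by (auto simp: vec_subspace_def add smult)
  have vc: "v \<in> carrier_vec m"
    using vec_subspaceD(2)[OF W v(1)] .
  have "adjoin ?K v = W"
  proof
    show "adjoin ?K v \<subseteq> W"
      using W v by (intro adjoin_minimal) auto
    show "W \<subseteq> adjoin ?K v"
    proof
      fix x assume x: "x \<in> W"
      \<comment> \<open>\<open>?y\<close> is the projection of \<open>x\<close> to the kernel along
        \<open>v\<close>.\<close>
      let ?a = "f x / f v" and ?y = "x + (- (f x / f v)) \<cdot>\<^sub>v v"
      have y: "?y \<in> ?K"
        using x v by (simp add: add smult vec_subspaceD[OF W])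
      have "x = ?y + ?a \<cdot>\<^sub>v v"
        using x vc by (intro eq_vecI) (auto dest!: vec_subspaceD(2)[OF W])
      then show "x \<in> adjoin ?K v"
        unfolding adjoin_def by (intro image_eqI[of _ _ "(?y, ?a)"]) (use y in auto)
    qed
  qed
  then show ?thesis
    using card_adjoin[OF K vc] v by simp
qed

subsection \<open>The symplectic form and the hull of an enlarged code\<close>

lemma symp_inner_add_left:
  "x \<in> carrier_vec (2 * n) \<Longrightarrow> y \<in> carrier_vec (2 * n) \<Longrightarrow>
    symp_inner n (x + y) z = symp_inner n x z + symp_inner n y z"
  by (simp add: symp_inner_def algebra_simps flip: sum.distrib)

lemma symp_inner_smult_left:
  "x \<in> carrier_vec (2 * n) \<Longrightarrow> symp_inner n (a \<cdot>\<^sub>v x) z = a * symp_inner n x z"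
  by (simp add: symp_inner_def algebra_simps sum_distrib_left)

lemma symp_inner_commute: "symp_inner n y x = - symp_inner n x y"
  by (simp add: symp_inner_def algebra_simps flip: sum_negf)

lemma symp_inner_commute_0: "symp_inner n y x = 0 \<longleftrightarrow> symp_inner n x y = 0"
  by (subst symp_inner_commute) simp

lemma symp_inner_self [simp]: "symp_inner n x x = 0"
  by (simp add: symp_inner_def mult.commute)

lemma symp_inner_add_right:
  "x \<in> carrier_vec (2 * n) \<Longrightarrow> y \<in> carrier_vec (2 * n) \<Longrightarrow>
    symp_inner n z (x + y) = symp_inner n z x + symp_inner n z y"
  by (simp add: symp_inner_add_left symp_inner_commute[of n z])

lemma symp_inner_smult_right:
  "x \<in> carrier_vec (2 * n) \<Longrightarrow> symp_inner n z (a \<cdot>\<^sub>v x) = a * symp_inner n z x"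
  by (simp add: symp_inner_smult_left symp_inner_commute[of n z])

lemma symp_inner_zero_left [simp]: "symp_inner n (0\<^sub>v (2 * n)) y = 0"
  by (simp add: symp_inner_def)

text \<open>Pairing with the unit vector in the conjugate position, \<open>n\<close> places further
  or \<open>n\<close> places back, isolates a nonzero coordinate of \<open>x\<close> up to
  sign.\<close>

lemma symp_inner_nondegenerate:
  assumes x: "x \<in> carrier_vec (2 * n)" "x \<noteq> 0\<^sub>v (2 * n)"
  obtains y where "y \<in> carrier_vec (2 * n)" "symp_inner n x y \<noteq> 0"
proof -
  obtain k where k: "k < 2 * n" "x $ k \<noteq> 0"
    using x by (metis carrier_vecD eq_vecI index_zero_vec)
  show ?thesis
  proof (cases "k < n")
    case True
    have "symp_inner n x (unit_vec (2 * n) (n + k)) = (\<Sum>i<n. if i = k then x $ i else 0)"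
      unfolding symp_inner_def using True by (intro sum.cong) auto
    also have "\<dots> = x $ k"
      using True by simp
    finally show ?thesis
      using that[of "unit_vec (2 * n) (n + k)"] k by simp
  next
    case False
    have "symp_inner n x (unit_vec (2 * n) (k - n)) = (\<Sum>i<n. if i = k - n then - x $ (n + i) else 0)"
      unfolding symp_inner_def using False k by (intro sum.cong) auto
    also have "\<dots> = - x $ k"
      using False k by simp
    finally show ?thesis
      using that[of "unit_vec (2 * n) (k - n)"] k by simp
  qed
qed

section \<open>Duals over a finite field and the dual of the hull\<close>

lemma symp_dual_subspace:
  assumes "C \<subseteq> carrier_vec (2 * n)"
  shows "vec_subspace (2 * n) (symp_dual n C)"
  using assms unfolding vec_subspace_def symp_dual_def
  by (auto simp: symp_inner_add_right symp_inner_smult_right symp_inner_commute[of n _ "0\<^sub>v (2 * n)"])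

lemma symp_hull_subspace:
  "vec_subspace (2 * n) C \<Longrightarrow> vec_subspace (2 * n) (symp_hull n C)"
  unfolding symp_hull_def by (intro vec_subspace_Int symp_dual_subspace) (auto dest: vec_subspaceD(1))

text \<open>Double counting of the orthogonal pairs in \<open>R\<close> times the ambient space. By
  nondegeneracy a nonzero \<open>x\<close> is orthogonal to one \<open>q\<close>-th of the space; a
  \<open>y\<close> outside the dual is orthogonal to one \<open>q\<close>-th of
  \<open>R\<close>.\<close>

lemma card_symp_dual:
  fixes R :: "'a::{field,finite} vec set"
  assumes R: "vec_subspace (2 * n) R"
  shows "card R * card (symp_dual n R) = CARD('a) ^ (2 * n)"
proof -
  let ?V = "carrier_vec (2 * n) :: 'a vec set" and ?D = "symp_dual n R"
  let ?z = "\<lambda>x y. of_bool (symp_inner n x y = 0) :: real"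
  define q where "q = real CARD('a)"
  have q: "q > 1"
    using card_mono[of "UNIV :: 'a set" "{0, 1}"] by (simp add: q_def)
  have fin: "finite R" and Rc: "R \<subseteq> ?V"
    using R by (auto intro: finite_vec_subspace dest: vec_subspaceD(1))
  have D: "?D \<subseteq> ?V"
    by (auto simp: symp_dual_def)
  have by_left: "q * (\<Sum>y\<in>?V. ?z x y) = (if x = 0\<^sub>v (2 * n) then q else 1) * card ?V" if x: "x \<in> R" for x
  proof (cases "x = 0\<^sub>v (2 * n)")
    case False
    then obtain y where y: "y \<in> ?V" "symp_inner n x y \<noteq> 0"
      using symp_inner_nondegenerate[of x n] x Rc by blast
    have "card ?V = CARD('a) * card {y \<in> ?V. symp_inner n x y = 0}"
      by (rule card_eq_card_kernel[where f = "symp_inner n x", OF vec_subspace_carrier _ _ y])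
        (simp_all add: symp_inner_add_right symp_inner_smult_right)
    then show ?thesis
      using False by (simp add: q_def Int_def)
  qed simp
  have by_right: "q * (\<Sum>x\<in>R. ?z x y) = (if y \<in> ?D then q else 1) * card R" if y: "y \<in> ?V" for y
  proof (cases "y \<in> ?D")
    case True
    then show ?thesis
      by (simp add: symp_dual_def)
  next
    case False
    then obtain x where x: "x \<in> R" "symp_inner n x y \<noteq> 0"
      using y by (auto simp: symp_dual_def)
    have "card R = CARD('a) * card {x \<in> R. symp_inner n x y = 0}"
      using Rc by (intro card_eq_card_kernel[where f = "\<lambda>x. symp_inner n x y", OF R _ _ x])
        (auto simp: symp_inner_add_left symp_inner_smult_left subset_iff)
    then show ?thesis
      using False fin by (simp add: q_def Int_def)
  qed
  have "(\<Sum>x\<in>R. q * (\<Sum>y\<in>?V. ?z x y)) = (\<Sum>y\<in>?V. q * (\<Sum>x\<in>R. ?z x y))"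
    by (simp only: sum_distrib_left sum.swap[of _ ?V R])
  \<comment> \<open>The weight \<open>q\<close> or 1 is written as 1 plus an optional
    \<open>q - 1\<close>. The ones contribute \<open>card R * card ?V\<close> on both sides and
    cancel.\<close>
  also have "(\<Sum>x\<in>R. q * (\<Sum>y\<in>?V. ?z x y)) =
      (\<Sum>x\<in>R. (if x = 0\<^sub>v (2 * n) then q - 1 else 0) + 1) * card ?V"
    unfolding sum_distrib_right by (intro sum.cong refl) (simp only: by_left, simp)
  also have "(\<Sum>y\<in>?V. q * (\<Sum>x\<in>R. ?z x y)) =
      (\<Sum>y\<in>?V. (if y \<in> ?D then q - 1 else 0) + 1) * card R"
    unfolding sum_distrib_right by (intro sum.cong refl) (simp only: by_right, simp)
  finally have "((q - 1) + card R) * card ?V = ((q - 1) * card ?D + card ?V) * card R"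
    using fin vec_subspaceD(3)[OF R] D by (simp add: sum.distrib sum.delta Int_absorb1 flip: sum.inter_restrict)
  then have "(q - 1) * card ?V = (q - 1) * (card R * card ?D)"
    by (simp add: algebra_simps)
  then have "real (card ?V) = real (card R * card ?D)"
    using q by simp
  then show ?thesis
    by (simp only: of_nat_eq_iff card_carrier_vec)
qed

text \<open>One inclusion is immediate, and applying \<open>card_symp_dual\<close> to
  \<open>C\<close> and to its dual shows that the two finite sets have equal size.\<close>

lemma symp_dual_symp_dual:
  fixes C :: "'a::{field,finite} vec set"
  assumes C: "vec_subspace (2 * n) C"
  shows "symp_dual n (symp_dual n C) = C"
proof -
  let ?D = "symp_dual n C"
  have D: "vec_subspace (2 * n) ?D"
    by (rule symp_dual_subspace[OF vec_subspaceD(1)[OF C]])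
  have DD: "vec_subspace (2 * n) (symp_dual n ?D)"
    by (rule symp_dual_subspace[OF vec_subspaceD(1)[OF D]])
  have "C \<subseteq> symp_dual n ?D"
    using vec_subspaceD(1)[OF C] by (auto simp: symp_dual_def symp_inner_commute_0)
  moreover have "card ?D * card C = card ?D * card (symp_dual n ?D)"
    using card_symp_dual[OF C] card_symp_dual[OF D] by (simp add: mult.commute)
  then have "card C = card (symp_dual n ?D)"
    using finite_vec_subspace[OF D] vec_subspaceD(3)[OF D] by auto
  ultimately show ?thesis
    using card_subset_eq[OF finite_vec_subspace[OF DD]] by metis
qed

text \<open>The dual of an intersection is the sum of the duals. The sum \<open>S\<close> of
  \<open>C\<close> and its dual satisfies \<open>symp_dual n S \<subseteq> symp_hull n C\<close>;
  taking duals reverses this inclusion, and \<open>S\<close> is its own double dual.\<close>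

lemma symp_dual_symp_hull:
  fixes C :: "'a::{field,finite} vec set"
  assumes C: "vec_subspace (2 * n) C" and v: "v \<in> symp_dual n (symp_hull n C)"
  obtains c d where "c \<in> C" "d \<in> symp_dual n C" "v = c + d"
proof -
  define S where "S = {c + d | c d. c \<in> C \<and> d \<in> symp_dual n C}"
  have D: "vec_subspace (2 * n) (symp_dual n C)"
    by (rule symp_dual_subspace[OF vec_subspaceD(1)[OF C]])
  note CD = vec_subspaceD[OF C] vec_subspaceD[OF D]
  have S: "vec_subspace (2 * n) S"
    unfolding vec_subspace_def
  proof (intro conjI ballI allI)
    show "S \<subseteq> carrier_vec (2 * n)"
      using CD(2,7) by (auto simp: S_def)
    have "0\<^sub>v (2 * n) = 0\<^sub>v (2 * n) + (0\<^sub>v (2 * n) :: 'a vec)"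
      by (intro eq_vecI) auto
    then show "0\<^sub>v (2 * n) \<in> S"
      using CD(3,8) unfolding S_def by blast
  next
    fix x y assume "x \<in> S" "y \<in> S"
    then obtain a b c d where *: "a \<in> C" "b \<in> C" "c \<in> symp_dual n C" "d \<in> symp_dual n C"
      "x = a + c" "y = b + d"
      unfolding S_def by blast
    have "x + y = (a + b) + (c + d)"
      using * CD(2)[of a] CD(2)[of b] CD(7)[of c] CD(7)[of d] by (intro eq_vecI) auto
    then show "x + y \<in> S"
      using CD(4)[OF *(1,2)] CD(9)[OF *(3,4)] unfolding S_def by blast
  next
    fix x k assume "x \<in> S"
    then obtain a c where *: "a \<in> C" "c \<in> symp_dual n C" "x = a + c"
      unfolding S_def by blast
    have "k \<cdot>\<^sub>v x = k \<cdot>\<^sub>v a + k \<cdot>\<^sub>v c"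
      using * CD(2)[of a] CD(7)[of c] by (intro eq_vecI) (auto simp: algebra_simps)
    then show "k \<cdot>\<^sub>v x \<in> S"
      using CD(5)[OF *(1)] CD(10)[OF *(2)] unfolding S_def by blast
  qed
  have CS: "C \<subseteq> S"
  proof
    fix c assume c: "c \<in> C"
    then have "c = c + 0\<^sub>v (2 * n)" using CD(2) by simp
    then show "c \<in> S" using c CD(8) unfolding S_def by blast
  qed
  have DS: "symp_dual n C \<subseteq> S"
  proof
    fix d assume d: "d \<in> symp_dual n C"
    then have "d = 0\<^sub>v (2 * n) + d" using CD(7) by simp
    then show "d \<in> S" using d CD(3) unfolding S_def by blast
  qed
  have "symp_dual n S \<subseteq> symp_dual n C \<inter> symp_dual n (symp_dual n C)"
    using CS DS by (auto simp: symp_dual_def)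
  then have "symp_dual n S \<subseteq> symp_hull n C"
    by (auto simp: symp_hull_def symp_dual_symp_dual[OF C])
  then have "v \<in> symp_dual n (symp_dual n S)"
    using v by (auto simp: symp_dual_def)
  then have "v \<in> S"
    by (simp add: symp_dual_symp_dual[OF S])
  then show ?thesis
    using that by (auto simp: S_def)
qed

text \<open>Writing \<open>v = c + d\<close> with \<open>c\<close> in \<open>C\<close> and
  \<open>d\<close> orthogonal to \<open>C\<close>, one may adjoin \<open>d\<close> instead of
  \<open>v\<close>. As the form is alternating, \<open>d\<close> is orthogonal to the whole enlarged
  code, so the hull grows by exactly the line through \<open>d\<close>.\<close>

lemma card_symp_hull_adjoin_up:
  fixes C :: "'a::{field,finite} vec set"
  assumes C: "vec_subspace (2 * n) C" and v: "v \<notin> C" "v \<in> symp_dual n (symp_hull n C)"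
  shows "card (symp_hull n (adjoin C v)) = CARD('a) * card (symp_hull n C)"
proof -
  obtain c d where c: "c \<in> C" and d: "d \<in> symp_dual n C" and v_eq: "v = c + d"
    using symp_dual_symp_hull[OF C v(2)] .
  have cc: "c \<in> carrier_vec (2 * n)" and dc: "d \<in> carrier_vec (2 * n)"
    using c d C by (auto simp: symp_dual_def dest: vec_subspaceD(2))
  have vc: "v \<in> carrier_vec (2 * n)"
    using cc dc v_eq by simp
  have dC: "d \<notin> C"
    using v(1) v_eq c vec_subspaceD(4)[OF C] by blast
  have R: "vec_subspace (2 * n) (symp_hull n C)"
    by (rule symp_hull_subspace[OF C])
  have C': "vec_subspace (2 * n) (adjoin C v)"
    by (rule adjoin_subspace[OF C vc])
  have d_eq: "d = v - c"
    using v_eq cc dc by (intro eq_vecI) auto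
  have "v \<in> adjoin C v" "C \<subseteq> adjoin C v"
    using in_adjoin[OF C vc] subset_adjoin[OF C vc] .
  then have dC': "d \<in> adjoin C v"
    using vec_subspace_diff[OF C'] c d_eq by blast
  have perp_v: "symp_inner n x v = symp_inner n x c + symp_inner n x d" for x
    using v_eq cc dc by (simp add: symp_inner_add_right)
  have "symp_hull n (adjoin C v) = adjoin (symp_hull n C) d"
  proof
    \<comment> \<open>Since \<open>v = c + d\<close>, orthogonality to \<open>C\<close> and to
      \<open>d\<close> implies orthogonality to \<open>v\<close> and hence to all of
      \<open>adjoin C v\<close>.\<close>
    have inner_C': "symp_inner n z y = 0"
      if z: "z \<in> adjoin C v" and y: "y \<in> carrier_vec (2 * n)"
        "\<And>x. x \<in> C \<Longrightarrow> symp_inner n x y = 0" "symp_inner n d y = 0" for y z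
    proof -
      obtain x a where "x \<in> C" "z = x + a \<cdot>\<^sub>v v"
        using z by (auto simp: adjoin_def)
      then show ?thesis
        using y c vc cc dc vec_subspaceD(2)[OF C] v_eq
        by (simp add: symp_inner_add_left symp_inner_smult_left)
    qed
    show "adjoin (symp_hull n C) d \<subseteq> symp_hull n (adjoin C v)"
    proof (rule adjoin_minimal[OF symp_hull_subspace[OF C']])
      show "d \<in> symp_hull n (adjoin C v)"
        using dC' d inner_C'[of _ d] by (auto simp: symp_hull_def symp_dual_def)
      have "symp_inner n d x = 0" if "x \<in> C" for x
        using d that by (subst symp_inner_commute_0) (auto simp: symp_dual_def)
      then show "symp_hull n C \<subseteq> symp_hull n (adjoin C v)"
        using \<open>C \<subseteq> adjoin C v\<close> inner_C' by (auto simp: symp_hull_def symp_dual_def)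
    qed
    show "symp_hull n (adjoin C v) \<subseteq> adjoin (symp_hull n C) d"
    proof
      fix x assume x: "x \<in> symp_hull n (adjoin C v)"
      then obtain y a where y: "y \<in> C" and x_eq: "x = y + a \<cdot>\<^sub>v v"
        by (auto simp: symp_hull_def adjoin_def)
      \<comment> \<open>Trading \<open>v\<close> for \<open>d\<close> moves the multiple of
        \<open>c\<close> into the component in \<open>C\<close>; this component turns out to lie in
        the old hull.\<close>
      define r where "r = y + a \<cdot>\<^sub>v c"
      have r: "r \<in> C"
        using y c C by (simp add: r_def vec_subspaceD)
      have rc: "r \<in> carrier_vec (2 * n)"
        using vec_subspaceD(2)[OF C r] .
      have x_eq': "x = r + a \<cdot>\<^sub>v d"
        unfolding x_eq r_def v_eq using cc dc vec_subspaceD(2)[OF C y]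
        by (intro eq_vecI) (auto simp: algebra_simps)
      have "symp_inner n z r = 0" if z: "z \<in> C" for z
      proof -
        have "symp_inner n z x = 0"
          using x z \<open>C \<subseteq> adjoin C v\<close> by (auto simp: symp_hull_def symp_dual_def)
        moreover have "symp_inner n z d = 0"
          using d z by (auto simp: symp_dual_def)
        ultimately show ?thesis
          using rc dc by (simp add: x_eq' symp_inner_add_right symp_inner_smult_right)
      qed
      then have "r \<in> symp_hull n C"
        using r rc by (simp add: symp_hull_def symp_dual_def)
      then show "x \<in> adjoin (symp_hull n C) d"
        unfolding adjoin_def x_eq' by (intro image_eqI[of _ _ "(r, a)"]) auto
    qed
  qed
  then show ?thesis
    using card_adjoin[OF R dc] dC by (simp add: symp_hull_def)
qed

text \<open>Some \<open>r\<close> in the old hull is not orthogonal to \<open>v\<close>. Testing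
  \<open>y + a v\<close> in the new hull against \<open>r\<close> forces \<open>a = 0\<close>, so
  the new hull is the kernel of the pairing with \<open>v\<close> on the old one.\<close>

lemma card_symp_hull_adjoin_down:
  fixes C :: "'a::{field,finite} vec set"
  assumes C: "vec_subspace (2 * n) C" and v: "v \<in> carrier_vec (2 * n)" "v \<notin> symp_dual n (symp_hull n C)"
  shows "card (symp_hull n C) = CARD('a) * card (symp_hull n (adjoin C v))"
proof -
  have R: "vec_subspace (2 * n) (symp_hull n C)"
    by (rule symp_hull_subspace[OF C])
  obtain r where r: "r \<in> symp_hull n C" "symp_inner n r v \<noteq> 0"
    using v by (auto simp: symp_dual_def)
  have "symp_hull n (adjoin C v) = {x \<in> symp_hull n C. symp_inner n x v = 0}"
  proof
    show "symp_hull n (adjoin C v) \<subseteq> {x \<in> symp_hull n C. symp_inner n x v = 0}"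
    proof
      fix x assume x: "x \<in> symp_hull n (adjoin C v)"
      then obtain y a where y: "y \<in> C" and x_eq: "x = y + a \<cdot>\<^sub>v v"
        by (auto simp: symp_hull_def adjoin_def)
      have yc: "y \<in> carrier_vec (2 * n)"
        using vec_subspaceD(2)[OF C y] .
      have perp: "symp_inner n z x = 0" if "z \<in> adjoin C v" for z
        using x that by (auto simp: symp_hull_def symp_dual_def)
      have "r \<in> C"
        using r by (simp add: symp_hull_def)
      then have "symp_inner n r x = 0"
        using perp subset_adjoin[OF C v(1)] by blast
      moreover have "symp_inner n r y = 0"
        using r y \<open>r \<in> C\<close> symp_inner_commute_0[of n r y] by (auto simp: symp_hull_def symp_dual_def)
      ultimately have "a = 0"
        using r yc v by (simp add: x_eq symp_inner_add_right symp_inner_smult_right)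
      then have "x = y"
        unfolding x_eq using yc v(1) by (intro eq_vecI) auto
      then show "x \<in> {x \<in> symp_hull n C. symp_inner n x v = 0}"
        using perp y yc subset_adjoin[OF C v(1)] in_adjoin[OF C v(1)] symp_inner_commute_0[of n v x]
        by (auto simp: symp_hull_def symp_dual_def)
    qed
    show "{x \<in> symp_hull n C. symp_inner n x v = 0} \<subseteq> symp_hull n (adjoin C v)"
    proof clarify
      fix x assume x: "x \<in> symp_hull n C" "symp_inner n x v = 0"
      then have xC: "x \<in> C" "x \<in> carrier_vec (2 * n)" "\<And>y. y \<in> C \<Longrightarrow> symp_inner n y x = 0"
        by (auto simp: symp_hull_def symp_dual_def)
      have "symp_inner n z x = 0" if z: "z \<in> adjoin C v" for z
      proof -
        obtain y a where "y \<in> C" "z = y + a \<cdot>\<^sub>v v"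
          using z by (auto simp: adjoin_def)
        moreover have "symp_inner n v x = 0"
          using x(2) symp_inner_commute_0[of n v x] by simp
        ultimately show ?thesis
          using xC(3) v(1) vec_subspaceD(2)[OF C]
          by (simp add: symp_inner_add_left symp_inner_smult_left)
      qed
      then show "x \<in> symp_hull n (adjoin C v)"
        using xC subset_adjoin[OF C v(1)] by (auto simp: symp_hull_def symp_dual_def)
    qed
  qed
  moreover have "card (symp_hull n C) = CARD('a) * card {x \<in> symp_hull n C. symp_inner n x v = 0}"
    using v(1) vec_subspaceD(2)[OF R]
    by (intro card_eq_card_kernel[where f = "\<lambda>x. symp_inner n x v", OF R _ _ r])
      (simp_all add: symp_inner_add_left symp_inner_smult_left)
  ultimately show ?thesis
    by simp
qed

subsection \<open>Counting independent tuples by hull dimension\<close>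

fun list_span :: "nat \<Rightarrow> 'a :: field vec list \<Rightarrow> 'a vec set" where
  "list_span m [] = {0\<^sub>v m}"
| "list_span m (v # vs) = adjoin (list_span m vs) v"

text \<open>Linear independence in incremental form: each vector lies outside the span of the later
  entries. This matches building a code one vector at a time, with the newest vector at the
  head.\<close>

fun independent_list :: "nat \<Rightarrow> 'a :: field vec list \<Rightarrow> bool" where
  "independent_list m [] \<longleftrightarrow> True"
| "independent_list m (v # vs) \<longleftrightarrow> v \<in> carrier_vec m - list_span m vs \<and> independent_list m vs"

definition frames :: "nat \<Rightarrow> nat \<Rightarrow> 'a :: field vec list set" where
  "frames m k = {vs. length vs = k \<and> independent_list m vs}"

lemma list_span_subspace: "independent_list m vs \<Longrightarrow> vec_subspace m (list_span m vs)"
  by (induction vs) (auto intro: adjoin_subspace)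

lemma card_list_span:
  "independent_list m (vs :: 'a::{field,finite} vec list) \<Longrightarrow> card (list_span m vs) = CARD('a) ^ length vs"
  by (induction vs) (auto simp: card_adjoin[OF list_span_subspace])

lemma frames_0 [simp]: "frames m 0 = {[]}"
  by (auto simp: frames_def)

text \<open>Splitting off the head. The property \<open>P\<close> of the span is left general
  because it serves both for spans inside a fixed subspace and for spans with a given hull
  dimension.\<close>

lemma frames_Suc:
  "{vs \<in> frames m (Suc k). P (list_span m vs)} =
    (\<lambda>(vs, v). v # vs) ` (SIGMA vs:frames m k. {v \<in> carrier_vec m - list_span m vs. P (adjoin (list_span m vs) v)})"
  by (auto simp: frames_def length_Suc_conv image_iff)

lemma finite_frames [simp]: "finite (frames m k :: 'a::{field,finite} vec list set)"
proof (induction k)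
  case (Suc k)
  have "finite (SIGMA vs:frames m k. {v \<in> carrier_vec m - list_span m (vs :: 'a vec list). True})"
    using Suc by (intro finite_SigmaI) auto
  then show ?case
    using frames_Suc[of m k "\<lambda>_ :: 'a vec set. True"] by simp
qed simp

lemma card_frames_Suc:
  "card {vs \<in> frames m (Suc k). P (list_span m (vs :: 'a::{field,finite} vec list))} =
    (\<Sum>vs\<in>frames m k. card {v \<in> carrier_vec m - list_span m vs. P (adjoin (list_span m vs) v)})"
  unfolding frames_Suc by (subst card_image) (auto simp: inj_on_def intro!: card_SigmaI)

text \<open>Once \<open>k\<close> independent vectors of \<open>W\<close> are chosen,
  \<open>card W - q ^ k\<close> choices remain for the next one. The formula stays valid beyond the
  dimension of \<open>W\<close>, where a factor is zero.\<close>

lemma card_frames_in_subspace: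
  fixes W :: "'a::{field,finite} vec set"
  assumes W: "vec_subspace m W"
  shows "real (card {vs \<in> frames m k. list_span m vs \<subseteq> W}) = (\<Prod>i<k. real (card W) - real CARD('a) ^ i)"
proof (induction k)
  case 0
  have "{vs \<in> {[]}. list_span m vs \<subseteq> W} = {[]}"
    using vec_subspaceD(3)[OF W] by auto
  then show ?case
    by (simp del: Collect_conv_if)
next
  case (Suc k)
  have "real (card {v \<in> carrier_vec m - list_span m vs. adjoin (list_span m vs) v \<subseteq> W})
      = (if list_span m vs \<subseteq> W then real (card W) - real CARD('a) ^ k else 0)"
    if "vs \<in> frames m k" for vs :: "'a vec list"
  proof -
    have vs: "independent_list m vs" "length vs = k"
      using that by (auto simp: frames_def)
    note S = list_span_subspace[OF vs(1)]
    have sub: "adjoin (list_span m vs) v \<subseteq> W \<longleftrightarrow> list_span m vs \<subseteq> W \<and> v \<in> W" if "v \<in> carrier_vec m" for v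
      using subset_adjoin[OF S that] in_adjoin[OF S that] adjoin_minimal[OF W] by blast
    have "{v \<in> carrier_vec m - list_span m vs. adjoin (list_span m vs) v \<subseteq> W} =
        (if list_span m vs \<subseteq> W then W - list_span m vs else {})"
      using sub vec_subspaceD(1)[OF W] by auto
    then show ?thesis
      using card_list_span[OF vs(1)] vs(2) finite_vec_subspace[OF S]
        card_mono[OF finite_vec_subspace[OF W], of "list_span m vs"]
      by (auto simp: card_Diff_subset of_nat_diff)
  qed
  then have "real (card {vs \<in> frames m (Suc k). list_span m vs \<subseteq> W})
      = (\<Sum>vs\<in>frames m k. if list_span m vs \<subseteq> W then real (card W) - real CARD('a) ^ k else 0)"
    unfolding card_frames_Suc[where P = "\<lambda>U. U \<subseteq> W"] of_nat_sum by (intro sum.cong refl)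
  also have "\<dots> = real (card {vs \<in> frames m k. list_span m vs \<subseteq> W}) * (real (card W) - real CARD('a) ^ k)"
    by (simp flip: sum.inter_filter)
  finally show ?case
    using Suc by simp
qed

text \<open>A frame of length \<open>k\<close> inside \<open>W\<close> spans \<open>q ^ k\<close>
  vectors, hence all of \<open>W\<close>; these are the ordered bases of \<open>W\<close>.\<close>

lemma card_frames_of_subspace:
  fixes W :: "'a::{field,finite} vec set"
  assumes W: "vec_subspace m W" and k: "card W = CARD('a) ^ k"
  shows "real (card {vs \<in> frames m k. list_span m vs = W}) = (\<Prod>i<k. real CARD('a) ^ k - real CARD('a) ^ i)"
proof -
  have "list_span m vs = W \<longleftrightarrow> list_span m vs \<subseteq> W" if "vs \<in> frames m k" for vs
    using that card_list_span[of m vs] k card_subset_eq[OF finite_vec_subspace[OF W]]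
    by (auto simp: frames_def)
  then have "{vs \<in> frames m k. list_span m vs = W} = {vs \<in> frames m k. list_span m vs \<subseteq> W}"
    by auto
  then show ?thesis
    using card_frames_in_subspace[OF W, of k] k by simp
qed

section \<open>Passing from codes to frames with prescribed hull dimension\<close>

lemma CARD_field_ge_2: "CARD('a::{field,finite}) \<ge> 2"
  using card_mono[of "UNIV :: 'a set" "{0, 1}"] by simp

lemma vdim_eq_iff:
  fixes W :: "'a::{field,finite} vec set"
  assumes "vec_subspace m W"
  shows "vdim m W = k \<longleftrightarrow> card W = CARD('a) ^ k"
  using card_eq_power_vdim[OF assms] CARD_field_ge_2[where 'a = 'a] by simp

lemma SHull_eq:
  "(SHull n k l :: 'a::{field,finite} vec set set) =
    {C. vec_subspace (2 * n) C \<and> card C = CARD('a) ^ k \<and> card (symp_hull n C) = CARD('a) ^ l}"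
  by (auto simp: SHull_def linear_codes_def subspace_iff_vec_subspace vdim_eq_iff symp_hull_subspace
      intro: card_eq_power_vdim)

lemma SLCD_eq_SHull: "(SLCD n k :: 'a::{field,finite} vec set set) = SHull n k 0"
proof -
  have "symp_LCD n C \<longleftrightarrow> vdim (2 * n) (symp_hull n C) = 0"
    if "vec_subspace (2 * n) C" for C :: "'a vec set"
  proof -
    note H = symp_hull_subspace[OF that]
    show ?thesis
      using vec_subspaceD(3)[OF H] by (auto simp: symp_LCD_def vdim_eq_iff[OF H] card_1_singleton_iff)
  qed
  then show ?thesis
    by (auto simp: SLCD_def SHull_def linear_codes_def subspace_iff_vec_subspace)
qed

definition hull_frames :: "nat \<Rightarrow> nat \<Rightarrow> nat \<Rightarrow> 'a :: field vec list set" where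
  "hull_frames n k r = {vs \<in> frames (2 * n) k. card (symp_hull n (list_span (2 * n) vs)) = CARD('a) ^ r}"

text \<open>The frames are partitioned by their span, and each code of dimension \<open>k\<close>
  has the same number of ordered bases.\<close>

lemma card_hull_frames_eq_card_SHull:
  "real (card (hull_frames n k l :: 'a::{field,finite} vec list set)) =
    real (card (SHull n k l :: 'a vec set set)) * (\<Prod>i<k. real CARD('a) ^ k - real CARD('a) ^ i)"
proof -
  let ?F = "\<lambda>C :: 'a vec set. {vs \<in> frames (2 * n) k. list_span (2 * n) vs = C}"
  have "SHull n k l \<subseteq> Pow (carrier_vec (2 * n) :: 'a vec set)"
    by (auto simp: SHull_eq dest: vec_subspaceD(2))
  then have fin: "finite (SHull n k l :: 'a vec set set)"
    by (rule finite_subset) simp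
  have "hull_frames n k l = (\<Union>C\<in>SHull n k l. ?F C)"
    by (auto simp: hull_frames_def SHull_eq frames_def list_span_subspace card_list_span)
  then have "card (hull_frames n k l :: 'a vec list set) = (\<Sum>C\<in>SHull n k l. card (?F C))"
    using fin by (simp only:) (rule card_UN_disjoint, auto)
  also have "real \<dots> = (\<Sum>C\<in>(SHull n k l :: 'a vec set set). \<Prod>i<k. real CARD('a) ^ k - real CARD('a) ^ i)"
    unfolding of_nat_sum by (intro sum.cong refl card_frames_of_subspace) (auto simp: SHull_eq)
  finally show ?thesis
    by simp
qed

text \<open>The vectors outside \<open>C\<close> fall into those outside the dual of the hull, which
  lower the hull dimension \<open>s\<close> by one, and those in the dual but not in
  \<open>C\<close>, which raise it by one. The dual has \<open>q ^ (2 * n) / q ^ s\<close> elements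
  and contains \<open>C\<close>.\<close>

lemma card_hull_transition:
  fixes C :: "'a::{field,finite} vec set"
  assumes C: "vec_subspace (2 * n) C" and s: "card (symp_hull n C) = CARD('a) ^ s"
  shows "real (card {v \<in> carrier_vec (2 * n) - C. card (symp_hull n (adjoin C v)) = CARD('a) ^ r}) =
    (if s = Suc r then real CARD('a) ^ (2 * n) - real CARD('a) ^ (2 * n) / real CARD('a) ^ s
     else if r = Suc s then real CARD('a) ^ (2 * n) / real CARD('a) ^ s - real (card C) else 0)"
proof -
  let ?q = "CARD('a)" and ?V = "carrier_vec (2 * n) :: 'a vec set"
  let ?D = "symp_dual n (symp_hull n C)"
  let ?A = "{v \<in> ?V - C. card (symp_hull n (adjoin C v)) = ?q ^ r}"
  have q: "?q > 1"
    using CARD_field_ge_2[where 'a = 'a] by simp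
  note R = symp_hull_subspace[OF C]
  have "C \<subseteq> ?D"
    using vec_subspaceD(1)[OF C] by (auto simp: symp_hull_def symp_dual_def symp_inner_commute_0)
  have "?D \<subseteq> ?V"
    by (auto simp: symp_dual_def)
  have "finite ?D"
    using \<open>?D \<subseteq> ?V\<close> by (rule finite_subset) simp
  have cardD: "real (card ?D) = real ?q ^ (2 * n) / real ?q ^ s"
    using arg_cong[OF card_symp_dual[OF R], of real] s q by (simp add: field_simps)
  have up: "card (symp_hull n (adjoin C v)) = ?q ^ r \<longleftrightarrow> r = Suc s" if "v \<in> ?D - C" for v
  proof -
    have "card (symp_hull n (adjoin C v)) = ?q ^ Suc s"
      using card_symp_hull_adjoin_up[OF C, of v] that s by simp
    then show ?thesis
      using q power_inject_exp[of ?q "Suc s" r] by auto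
  qed
  have down: "card (symp_hull n (adjoin C v)) = ?q ^ r \<longleftrightarrow> s = Suc r" if "v \<in> ?V - ?D" for v
  proof -
    have "?q ^ s = ?q * card (symp_hull n (adjoin C v))"
      using card_symp_hull_adjoin_down[OF C, of v] that s by simp
    moreover have "?q ^ s = ?q * ?q ^ r \<longleftrightarrow> s = Suc r"
      using q power_inject_exp[of ?q s "Suc r"] by simp
    ultimately show ?thesis
      using q by simp
  qed
  have "?V - C = (?V - ?D) \<union> (?D - C)"
    using \<open>C \<subseteq> ?D\<close> \<open>?D \<subseteq> ?V\<close> by auto
  then have "?A = (if s = Suc r then ?V - ?D else if r = Suc s then ?D - C else {})"
    using up down by auto
  then show ?thesis
    using \<open>finite ?D\<close> \<open>C \<subseteq> ?D\<close> \<open>?D \<subseteq> ?V\<close> cardD finite_vec_subspace[OF C]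
      card_mono[OF finite_carrier_vec \<open>?D \<subseteq> ?V\<close>] card_mono[OF \<open>finite ?D\<close> \<open>C \<subseteq> ?D\<close>]
    by (auto simp: card_Diff_subset of_nat_diff card_carrier_vec)
qed

lemma card_hull_frames_0: "card (hull_frames n 0 0 :: 'a::{field,finite} vec list set) = 1"
proof -
  have "symp_hull n {0\<^sub>v (2 * n)} = {0\<^sub>v (2 * n) :: 'a vec}"
    using vec_subspaceD(3)[OF symp_hull_subspace[OF vec_subspace_zero], of n]
    by (auto simp: symp_hull_def)
  then have "hull_frames n 0 0 = {[] :: 'a vec list}"
    by (auto simp: hull_frames_def)
  then show ?thesis
    by simp
qed

lemma hull_frames_empty:
  assumes "r > k"
  shows "hull_frames n k r = ({} :: 'a::{field,finite} vec list set)"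
proof -
  have "card (symp_hull n (list_span (2 * n) vs)) < CARD('a) ^ r" if "vs \<in> frames (2 * n) k"
    for vs :: "'a vec list"
  proof -
    have vs: "independent_list (2 * n) vs" "length vs = k"
      using that by (auto simp: frames_def)
    have "card (symp_hull n (list_span (2 * n) vs)) \<le> card (list_span (2 * n) vs)"
      using finite_vec_subspace[OF list_span_subspace[OF vs(1)]]
      by (intro card_mono) (auto simp: symp_hull_def)
    also have "\<dots> < CARD('a) ^ r"
      using CARD_field_ge_2[where 'a = 'a] assms by (simp add: card_list_span[OF vs(1)] vs(2))
    finally show ?thesis .
  qed
  then show ?thesis
    by (fastforce simp: hull_frames_def)
qed

text \<open>A frame with hull dimension \<open>r\<close> arises from a tail with hull dimension
  \<open>r + 1\<close> or \<open>r - 1\<close>; \<open>card_hull_transition\<close> counts the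
  possible heads. The test \<open>r = 0\<close> guards against the truncated
  \<open>r - 1\<close>.\<close>

lemma card_hull_frames_Suc:
  fixes n :: nat
  defines "q \<equiv> real CARD('a::{field,finite})"
  defines "f \<equiv> \<lambda>k r. real (card (hull_frames n k r :: 'a vec list set))"
  shows "f (Suc k) r = f k (Suc r) * (q ^ (2 * n) - q ^ (2 * n) / q ^ Suc r) +
    (if r = 0 then 0 else f k (r - 1) * (q ^ (2 * n) / q ^ (r - 1) - q ^ k))"
proof -
  let ?h = "\<lambda>vs :: 'a vec list. card (symp_hull n (list_span (2 * n) vs))"
  let ?a = "q ^ (2 * n) - q ^ (2 * n) / q ^ Suc r" and ?b = "q ^ (2 * n) / q ^ (r - 1) - q ^ k"
  have "real (card {v \<in> carrier_vec (2 * n) - list_span (2 * n) vs.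
        card (symp_hull n (adjoin (list_span (2 * n) vs) v)) = CARD('a) ^ r})
      = (if ?h vs = CARD('a) ^ Suc r then ?a else 0) + (if r \<noteq> 0 \<and> ?h vs = CARD('a) ^ (r - 1) then ?b else 0)"
    if "vs \<in> frames (2 * n) k" for vs :: "'a vec list"
  proof -
    have vs: "independent_list (2 * n) vs" "length vs = k"
      using that by (auto simp: frames_def)
    note S = list_span_subspace[OF vs(1)]
    obtain s where s: "?h vs = CARD('a) ^ s"
      using card_eq_power_vdim[OF symp_hull_subspace[OF S]] by blast
    have inj: "CARD('a) ^ s = CARD('a) ^ t \<longleftrightarrow> s = t" for t
      using CARD_field_ge_2[where 'a = 'a] by simp
    show ?thesis
      unfolding card_hull_transition[OF S s] card_list_span[OF vs(1)] vs(2) s inj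
      by (auto simp: q_def)
  qed
  then have "f (Suc k) r = (\<Sum>vs\<in>frames (2 * n) k. (if ?h vs = CARD('a) ^ Suc r then ?a else 0) +
      (if r \<noteq> 0 \<and> ?h vs = CARD('a) ^ (r - 1) then ?b else 0))"
    unfolding f_def hull_frames_def
      card_frames_Suc[where P = "\<lambda>W. card (symp_hull n W) = CARD('a) ^ r"] of_nat_sum
    by (intro sum.cong refl)
  also have "\<dots> = f k (Suc r) * ?a + (if r = 0 then 0 else f k (r - 1) * ?b)"
    by (simp add: sum.distrib f_def hull_frames_def del: power_Suc flip: sum.inter_filter)
  finally show ?thesis .
qed

subsection \<open>Solution of the recurrence and convergence\<close>

lemma g_fin_Suc: "g_fin Q (Suc n) = g_fin Q n * (1 - 1 / Q ^ Suc n)"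
  by (simp add: g_fin_def)

lemma h_prod_Suc: "h_prod Q (Suc n) = h_prod Q n * (Q ^ Suc n - 1)"
  by (simp add: h_prod_def)

lemma h_prod_pos: "Q > 1 \<Longrightarrow> h_prod Q n > 0"
  unfolding h_prod_def by (intro prod_pos) (auto simp: one_less_power)

lemma g_fin_pos: "Q > 1 \<Longrightarrow> g_fin Q n > 0"
  unfolding g_fin_def by (intro prod_pos) (auto simp: one_less_power)

text \<open>Each factor is \<open>Q ^ i * (1 - 1 / Q ^ i)\<close>, and the exponents 1 to
  \<open>n\<close> add up to the binomial coefficient.\<close>

lemma h_prod_eq_g_fin:
  assumes "Q > 1"
  shows "h_prod Q n = Q ^ (Suc n choose 2) * g_fin Q n"
proof (induction n)
  case (Suc n)
  have "Suc (Suc n) choose 2 = (Suc n choose 2) + Suc n"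
    by (simp add: numeral_2_eq_2)
  then show ?case
    using Suc assms by (simp add: h_prod_Suc g_fin_Suc power_add field_simps)
qed (simp add: h_prod_def g_fin_def numeral_2_eq_2)

text \<open>Pulling \<open>Q ^ N\<close> out of each factor leaves
  \<open>1 - 1 / Q ^ (N - i)\<close>, and these are the last \<open>k\<close> factors of
  \<open>g_fin Q N\<close>.\<close>

lemma prod_power_diff_eq_g_fin:
  assumes "Q > 1" "k \<le> N"
  shows "(\<Prod>i<k. Q ^ N - Q ^ i) = Q ^ (N * k) * g_fin Q N / g_fin Q (N - k)"
  using assms(2)
proof (induction k)
  case 0
  then show ?case
    using g_fin_pos[OF assms(1), of N] by simp
next
  case (Suc k)
  then obtain d where d: "N = d + Suc k"
    using le_Suc_ex by (metis add.commute)
  define c where "c = 1 - 1 / Q ^ Suc d"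
  have "Q ^ N - Q ^ k = Q ^ N * c"
    using assms(1) by (simp add: c_def d power_add field_simps)
  moreover have "N - k = Suc d" "N - Suc k = d"
    using d by auto
  moreover have "c > 0"
    using one_less_power[OF assms(1), of "Suc d"] by (simp add: c_def field_simps del: power_Suc)
  moreover have "g_fin Q (Suc d) = g_fin Q d * c"
    by (simp only: g_fin_Suc c_def)
  ultimately show ?case
    using Suc g_fin_pos[OF assms(1), of d] by (simp add: power_add)
qed

text \<open>The constant 1/4 alone does not survive an induction step; the additional term is halved
  each time and pays for the new factor.\<close>

lemma g_fin_lower_bound:
  assumes "Q \<ge> 2"
  shows "g_fin Q (Suc n) \<ge> 1 / 4 + 1 / 2 ^ (n + 2)"
proof (induction n)
  case 0
  have "1 / Q \<le> 1 / 2"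
    using assms by (simp add: field_simps)
  then show ?case
    by (simp add: g_fin_def)
next
  case (Suc n)
  define t :: real where "t = 1 / 2 ^ (n + 2)"
  have t: "0 < t" "t \<le> 1 / 4"
    by (auto simp: t_def field_simps)
  \<comment> \<open>The product \<open>(1 / 4 + t) * (1 - t)\<close> equals
    \<open>1 / 4 + 3 * t / 4 - t * t\<close>, so \<open>t \<le> 1 / 4\<close> leaves at least
    \<open>t / 2\<close> above 1/4.\<close>
  have "t * t \<le> t * (1 / 4)"
    using t by (intro mult_left_mono) auto
  then have "1 / 4 + t / 2 \<le> (1 / 4 + t) * (1 - t)"
    unfolding distrib_right right_diff_distrib by linarith
  also have "\<dots> \<le> g_fin Q (Suc n) * (1 - 1 / Q ^ Suc (Suc n))"
  proof (rule mult_mono)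
    have "2 ^ (n + 2) \<le> Q ^ (n + 2)"
      using assms by (intro power_mono) auto
    then have "1 / Q ^ (n + 2) \<le> t"
      unfolding t_def by (intro divide_left_mono) (use assms in auto)
    then show "1 - t \<le> 1 - 1 / Q ^ Suc (Suc n)"
      by simp
    show "1 / 4 + t \<le> g_fin Q (Suc n)"
      using Suc by (simp add: t_def)
  qed (use t g_fin_pos[of Q "Suc n"] assms in auto)
  finally show ?case
    unfolding g_fin_Suc[of Q "Suc n"] by (simp add: t_def)
qed

text \<open>The products decrease and are nonnegative, so \<open>lim\<close> denotes a genuine
  limit; the uniform bound 1/4 keeps that limit away from zero.\<close>

lemma
  assumes "Q \<ge> 2"
  shows g_fin_tendsto: "g_fin Q \<longlonglongrightarrow> g_inf Q" and g_inf_pos: "g_inf Q > 0"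
proof -
  have "decseq (g_fin Q)"
  proof (rule decseq_SucI)
    fix n
    show "g_fin Q (Suc n) \<le> g_fin Q n"
      unfolding g_fin_Suc using g_fin_pos[of Q n] assms by (intro mult_left_le) auto
  qed
  moreover have "\<forall>n. 0 \<le> g_fin Q n"
    using g_fin_pos[of Q] assms by (simp add: less_imp_le)
  ultimately obtain L where L: "g_fin Q \<longlonglongrightarrow> L"
    using decseq_convergent by blast
  then show lim: "g_fin Q \<longlonglongrightarrow> g_inf Q"
    using limI[OF L] by (simp add: g_inf_def)
  have "g_inf Q \<ge> 1 / 4"
  proof (rule tendsto_lowerbound[OF LIMSEQ_Suc[OF lim]])
    have "1 / 4 \<le> g_fin Q (Suc n)" for n
      using g_fin_lower_bound[OF assms, of n] by (rule order_trans[rotated]) simp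
    then show "\<forall>\<^sub>F n in sequentially. 1 / 4 \<le> g_fin Q (Suc n)"
      by simp
  qed simp
  then show "g_inf Q > 0"
    by linarith
qed

text \<open>The recurrence describes how the hull dimension changes when a code is enlarged by one
  vector; \<open>x\<close> stands for the number of vectors of the ambient space.\<close>

lemma hull_recurrence_solution:
  fixes f :: "nat \<Rightarrow> nat \<Rightarrow> real" and q x :: real
  assumes q: "q > 1"
    and f0: "f 0 0 = 1"
    and vanish: "\<And>k r. r > k \<Longrightarrow> f k r = 0"
    and rec: "\<And>k r. f (Suc k) r = f k (Suc r) * (x - x / q ^ Suc r) +
      (if r = 0 then 0 else f k (r - 1) * (x / q ^ (r - 1) - q ^ k))"
  shows "q ^ (j\<^sup>2 + 2 * j * r + (r choose 2)) * h_prod q r * h_prod (q\<^sup>2) j * f (2 * j + r) r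
    = h_prod q (2 * j + r) * x ^ j * (\<Prod>i<r + j. x - (q\<^sup>2) ^ i)"
proof -
  define e where "e j r = j\<^sup>2 + 2 * j * r + (r choose 2)" for j r :: nat
  define P where "P s = (\<Prod>i<s. x - (q\<^sup>2) ^ i)" for s
  \<comment> \<open>The increments of the exponent \<open>e\<close> supply the powers of
    \<open>q\<close> that clear the denominators in the two terms of the recurrence.\<close>
  have e_up: "e j (Suc r) = e j r + 2 * j + r" for j r
    by (simp add: e_def numeral_2_eq_2)
  have e_down: "e (Suc j) r = e j (Suc r) + Suc r" for j r
    by (simp add: e_def numeral_2_eq_2)
  \<comment> \<open>For fixed \<open>k\<close>, the recurrence at \<open>(j, r)\<close> calls on
    \<open>(j - 1, r + 1)\<close> and \<open>(j, r - 1)\<close>, so both indices must vary in the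
    induction.\<close>
  have "q ^ e j r * h_prod q r * h_prod (q\<^sup>2) j * f k r = h_prod q k * x ^ j * P (r + j)"
    if "k = 2 * j + r" for k
    using that
  proof (induction k arbitrary: j r)
    case 0
    then show ?case
      by (simp add: e_def h_prod_def P_def f0 numeral_2_eq_2)
  next
    case (Suc k)
    have up: "q ^ e j r * h_prod q r * h_prod (q\<^sup>2) j * (f k (Suc r) * (x - x / q ^ Suc r))
      = ((q\<^sup>2) ^ j - 1) * h_prod q k * x ^ j * P (r + j)"
    proof (cases j)
      case 0
      then show ?thesis
        \<comment> \<open>For \<open>j = 0\<close> the index is \<open>r = k + 1\<close>, and a hull
          of dimension \<open>r + 1\<close> exceeds \<open>k\<close>.\<close>
        using Suc.prems by (simp add: vanish)
    next
      case (Suc i)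
      have IH: "q ^ e i (Suc r) * h_prod q (Suc r) * h_prod (q\<^sup>2) i * f k (Suc r)
          = h_prod q k * x ^ i * P (Suc r + i)"
        using Suc.prems Suc by (intro Suc.IH) simp
      have "q ^ e j r * h_prod q r * h_prod (q\<^sup>2) j * (f k (Suc r) * (x - x / q ^ Suc r))
        = (q ^ e i (Suc r) * h_prod q (Suc r) * h_prod (q\<^sup>2) i * f k (Suc r)) * ((q\<^sup>2) ^ j - 1) * x"
        using q by (simp add: Suc e_down h_prod_Suc power_add field_simps del: power_Suc)
      also have "\<dots> = ((q\<^sup>2) ^ j - 1) * h_prod q k * x ^ j * P (r + j)"
        unfolding IH by (simp add: Suc)
      finally show ?thesis .
    qed
    have down: "q ^ e j r * h_prod q r * h_prod (q\<^sup>2) j *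
        (if r = 0 then 0 else f k (r - 1) * (x / q ^ (r - 1) - q ^ k))
      = (q\<^sup>2) ^ j * (q ^ r - 1) * h_prod q k * x ^ j * P (r + j)"
    proof (cases r)
      case 0
      then show ?thesis by simp
    next
      case (Suc p)
      have IH: "q ^ e j p * h_prod q p * h_prod (q\<^sup>2) j * f k p = h_prod q k * x ^ j * P (p + j)"
        using Suc.prems Suc by (intro Suc.IH) simp
      have k: "k = 2 * j + p"
        using Suc.prems Suc by simp
      have "(q\<^sup>2) ^ (p + j) = q ^ p * q ^ k"
        by (simp add: k algebra_simps flip: power_mult power_add)
      \<comment> \<open>Clearing the denominator produces exactly the last factor of
        \<open>P (r + j)\<close>.\<close>
      then have *: "q ^ p * (x / q ^ p - q ^ k) = x - (q\<^sup>2) ^ (p + j)"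
        using q by (simp add: field_simps)
      have "q ^ e j r = q ^ e j p * (q\<^sup>2) ^ j * q ^ p"
        by (simp only: Suc e_up power_add power_mult)
      then have "q ^ e j r * h_prod q r * h_prod (q\<^sup>2) j * (f k p * (x / q ^ p - q ^ k))
        = (q ^ e j p * h_prod q p * h_prod (q\<^sup>2) j * f k p) * ((q\<^sup>2) ^ j * (q ^ r - 1)) * (x - (q\<^sup>2) ^ (p + j))"
        unfolding *[symmetric] by (simp add: Suc h_prod_Suc algebra_simps del: power_Suc)
      also have "\<dots> = (q\<^sup>2) ^ j * (q ^ r - 1) * h_prod q k * x ^ j * P (r + j)"
        unfolding IH by (simp add: Suc P_def)
      finally show ?thesis
        using Suc by simp
    qed
    \<comment> \<open>The weights of the two contributions add up to \<open>q ^ Suc k - 1\<close>,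
      the new factor of \<open>h_prod\<close>.\<close>
    have key: "h_prod q (Suc k) = h_prod q k * ((q\<^sup>2) ^ j - 1 + (q\<^sup>2) ^ j * (q ^ r - 1))"
    proof -
      have "q ^ Suc k = (q\<^sup>2) ^ j * q ^ r"
        unfolding Suc.prems by (simp add: power_add power_mult)
      then show ?thesis
        unfolding h_prod_Suc by (simp add: algebra_simps)
    qed
    then show ?case
      unfolding rec distrib_left up down key by (simp add: algebra_simps)
  qed
  then show ?thesis
    by (simp add: e_def P_def)
qed

text \<open>Here \<open>n = m + l + j\<close> and \<open>k = 2 * j + l\<close>, so that \<open>k \<longrightarrow> \<infinity>\<close> and
  \<open>2 * n - k = 2 * m + l \<longrightarrow> \<infinity>\<close> become \<open>j \<longrightarrow> \<infinity>\<close> and \<open>m \<longrightarrow> \<infinity>\<close>.\<close>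

lemma SHull_ratio_eq:
  fixes l j m :: nat
  defines "q \<equiv> real CARD('a::{field,finite})"
  shows "real (card (SHull (m + l + j) (2 * j + l) l :: 'a vec set set)) /
      gauss_binomial q (2 * (m + l + j)) (2 * j + l) =
    q ^ l / h_prod q l * (g_fin q (2 * j + l) * g_fin (q\<^sup>2) (m + l + j) * g_fin q (2 * m + l)) /
      (g_fin (q\<^sup>2) j * g_fin (q\<^sup>2) m * g_fin q (2 * (m + l + j)))"
proof -
  define n where "n = m + l + j"
  define k where "k = 2 * j + l"
  define x where "x = q ^ (2 * n)"
  define N where "N = real (card (SHull n k l :: 'a vec set set))"
  define F where "F = real (card (hull_frames n k l :: 'a vec list set))"
  have q: "q > 1" "q \<noteq> 0"
    using CARD_field_ge_2[where 'a = 'a] by (auto simp: q_def)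
  have q2: "q\<^sup>2 > 1"
    using q by (simp add: one_less_power)
  note g_pos = g_fin_pos[OF q(1)] g_fin_pos[OF q2] h_prod_pos[OF q(1)]
  have "(\<Prod>i<k. q ^ k - q ^ i) > 0"
    using q by (intro prod_pos) (auto intro: power_strict_increasing)
  moreover have "N * (\<Prod>i<k. q ^ k - q ^ i) = F"
    using card_hull_frames_eq_card_SHull[of n k l, where 'a = 'a] by (simp add: N_def F_def q_def)
  \<comment> \<open>The number of ordered bases of a code is also the denominator of the Gaussian
    binomial, so the quotient compares frames with all independent \<open>k\<close>-tuples.\<close>
  ultimately have ratio: "N / gauss_binomial q (2 * n) k = F / (\<Prod>i<k. x - q ^ i)"
    by (simp add: gauss_binomial_def x_def field_simps)
  have "q ^ (j\<^sup>2 + 2 * j * l + (l choose 2)) * h_prod q l * h_prod (q\<^sup>2) j * F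
      = h_prod q k * x ^ j * (\<Prod>i<l + j. x - (q\<^sup>2) ^ i)"
    unfolding F_def k_def
  proof (rule hull_recurrence_solution[OF q(1)])
    show "real (card (hull_frames n (Suc k) r :: 'a vec list set)) =
      real (card (hull_frames n k (Suc r) :: 'a vec list set)) * (x - x / q ^ Suc r) +
      (if r = 0 then 0 else real (card (hull_frames n k (r - 1) :: 'a vec list set)) * (x / q ^ (r - 1) - q ^ k))" for k r
      unfolding x_def q_def by (rule card_hull_frames_Suc)
  qed (simp_all add: card_hull_frames_0 hull_frames_empty)
  also have "(\<Prod>i<l + j. x - (q\<^sup>2) ^ i) = x ^ (l + j) * g_fin (q\<^sup>2) n / g_fin (q\<^sup>2) m"
  proof -
    have x: "x = (q\<^sup>2) ^ n" and n: "l + j \<le> n" "n - (l + j) = m"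
      by (simp_all add: x_def n_def flip: power_mult)
    show ?thesis
      using prod_power_diff_eq_g_fin[OF q2 n(1)] unfolding x n(2) power_mult .
  qed
  also have "h_prod (q\<^sup>2) j = q ^ (j\<^sup>2 + j) * g_fin (q\<^sup>2) j"
  proof -
    have "2 * (Suc j choose 2) = j\<^sup>2 + j"
      by (simp add: choose_two power2_eq_square algebra_simps)
    then show ?thesis
      by (simp add: h_prod_eq_g_fin[OF q2] flip: power_mult)
  qed
  also have "h_prod q k = q ^ (Suc k choose 2) * g_fin q k"
    by (rule h_prod_eq_g_fin[OF q(1)])
  \<comment> \<open>The powers of \<open>q\<close> on the two sides differ exactly by
    \<open>q ^ l\<close>, the power in the limit.\<close>
  also have "Suc k choose 2 = (j\<^sup>2 + 2 * j * l + (l choose 2)) + (j\<^sup>2 + j) + l"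
  proof -
    have "2 * (i choose 2) = i * (i - 1)" for i :: nat
      by (cases i) (simp_all add: choose_two)
    note this[of "Suc k"] this[of l]
    then have "2 * (Suc k choose 2) = 2 * ((j\<^sup>2 + 2 * j * l + (l choose 2)) + (j\<^sup>2 + j) + l)"
      by (cases l) (simp_all add: k_def power2_eq_square algebra_simps)
    then show ?thesis
      by simp
  qed
  finally have "(h_prod q l * g_fin (q\<^sup>2) j * F) * (q ^ (j\<^sup>2 + 2 * j * l + (l choose 2)) * q ^ (j\<^sup>2 + j))
      = (q ^ l * g_fin q k * x ^ (j + (l + j)) * g_fin (q\<^sup>2) n / g_fin (q\<^sup>2) m) *
        (q ^ (j\<^sup>2 + 2 * j * l + (l choose 2)) * q ^ (j\<^sup>2 + j))"
    by (simp only: power_add mult_ac times_divide_eq_left times_divide_eq_right)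
  then have "h_prod q l * g_fin (q\<^sup>2) j * F
      = q ^ l * g_fin q k * x ^ (j + (l + j)) * g_fin (q\<^sup>2) n / g_fin (q\<^sup>2) m"
    by (rule mult_right_cancel[THEN iffD1, rotated]) (use q in simp)
  moreover have "j + (l + j) = k"
    by (simp add: k_def)
  ultimately have F: "F = q ^ l * g_fin q k * x ^ k * g_fin (q\<^sup>2) n / (g_fin (q\<^sup>2) m * h_prod q l * g_fin (q\<^sup>2) j)"
    using g_pos(2)[of j] g_pos(2)[of m] g_pos(3)[of l] by (simp add: field_simps)
  have P: "(\<Prod>i<k. x - q ^ i) = x ^ k * g_fin q (2 * n) / g_fin q (2 * m + l)"
  proof -
    have "2 * n - k = 2 * m + l" "k \<le> 2 * n"
      by (simp_all add: n_def k_def)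
    then show ?thesis
      using prod_power_diff_eq_g_fin[OF q(1), of k "2 * n"] by (simp add: x_def flip: power_mult)
  qed
  have "x \<noteq> 0"
    using q by (simp add: x_def)
  then have "N / gauss_binomial q (2 * n) k =
    q ^ l / h_prod q l * (g_fin q k * g_fin (q\<^sup>2) n * g_fin q (2 * m + l)) /
      (g_fin (q\<^sup>2) j * g_fin (q\<^sup>2) m * g_fin q (2 * n))"
    unfolding ratio F P
    using g_pos(1)[of "2 * n"] g_pos(1)[of "2 * m + l"] g_pos(2)[of j] g_pos(2)[of m] g_pos(3)[of l]
    by (simp add: field_simps)
  then show ?thesis
    by (simp only: N_def n_def k_def)
qed

text \<open>The product filter expresses the joint limit in \<open>j\<close> and \<open>m\<close>.
  Every index of \<open>g_fin\<close> is at least \<open>j\<close> or at least \<open>m\<close>, so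
  all six factors converge, and one copy each of \<open>g_inf q\<close> and
  \<open>g_inf (q\<^sup>2)\<close> cancels.\<close>

lemma SHull_ratio_tendsto:
  fixes l :: nat
  defines "q \<equiv> real CARD('a::{field,finite})"
  shows "((\<lambda>(j, m). real (card (SHull (m + l + j) (2 * j + l) l :: 'a vec set set)) /
      gauss_binomial q (2 * (m + l + j)) (2 * j + l))
    \<longlongrightarrow> q ^ l * g_inf q / (h_prod q l * g_inf (q\<^sup>2))) (sequentially \<times>\<^sub>F sequentially)"
proof -
  let ?F = "sequentially \<times>\<^sub>F sequentially :: (nat \<times> nat) filter"
  have q: "q \<ge> 2"
    using CARD_field_ge_2[where 'a = 'a] by (simp add: q_def)
  then have q2: "q\<^sup>2 \<ge> 2"
    using power_increasing[of 1 2 q] by simp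
  have f1: "filterlim (\<lambda>p. fst p) sequentially ?F" and f2: "filterlim (\<lambda>p. snd p) sequentially ?F"
    by (simp_all add: filterlim_def filtermap_fst_prod_filter filtermap_snd_prod_filter)
  have mono: "filterlim (\<lambda>p. a p) sequentially ?F"
    if "filterlim (\<lambda>p. b p) sequentially ?F" "\<And>p. b p \<le> a p" for a b :: "nat \<times> nat \<Rightarrow> nat"
    using that(1) by (rule filterlim_at_top_mono) (simp add: that(2))
  have lims: "((\<lambda>p. g_fin q (2 * fst p + l)) \<longlongrightarrow> g_inf q) ?F"
    "((\<lambda>p. g_fin (q\<^sup>2) (snd p + l + fst p)) \<longlongrightarrow> g_inf (q\<^sup>2)) ?F"
    "((\<lambda>p. g_fin q (2 * snd p + l)) \<longlongrightarrow> g_inf q) ?F"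
    "((\<lambda>p. g_fin (q\<^sup>2) (fst p)) \<longlongrightarrow> g_inf (q\<^sup>2)) ?F"
    "((\<lambda>p. g_fin (q\<^sup>2) (snd p)) \<longlongrightarrow> g_inf (q\<^sup>2)) ?F"
    "((\<lambda>p. g_fin q (2 * (snd p + l + fst p))) \<longlongrightarrow> g_inf q) ?F"
    by (rule filterlim_compose[OF g_fin_tendsto[OF q]] filterlim_compose[OF g_fin_tendsto[OF q2]],
        rule mono[OF f1] mono[OF f2], simp)+
  have "((\<lambda>p. q ^ l / h_prod q l * (g_fin q (2 * fst p + l) * g_fin (q\<^sup>2) (snd p + l + fst p) * g_fin q (2 * snd p + l)) /
      (g_fin (q\<^sup>2) (fst p) * g_fin (q\<^sup>2) (snd p) * g_fin q (2 * (snd p + l + fst p))))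
    \<longlongrightarrow> q ^ l / h_prod q l * (g_inf q * g_inf (q\<^sup>2) * g_inf q) / (g_inf (q\<^sup>2) * g_inf (q\<^sup>2) * g_inf q)) ?F"
    using g_inf_pos[OF q] g_inf_pos[OF q2] by (intro tendsto_intros lims) auto
  moreover have "q ^ l / h_prod q l * (g_inf q * g_inf (q\<^sup>2) * g_inf q) / (g_inf (q\<^sup>2) * g_inf (q\<^sup>2) * g_inf q)
      = q ^ l * g_inf q / (h_prod q l * g_inf (q\<^sup>2))"
    using g_inf_pos[OF q] g_inf_pos[OF q2] by (simp add: field_simps)
  ultimately show ?thesis
    unfolding q_def case_prod_unfold SHull_ratio_eq by simp
qed

lemma SHull_ratio_limit:
  fixes l :: nat and \<epsilon> :: real
  defines "q \<equiv> real CARD('a::{field,finite})"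
  assumes "\<epsilon> > 0"
  obtains M where "\<And>n j. M \<le> j \<Longrightarrow> M + l + j \<le> n \<Longrightarrow>
    \<bar>real (card (SHull n (2 * j + l) l :: 'a vec set set)) / gauss_binomial q (2 * n) (2 * j + l)
      - q ^ l * g_inf q / (h_prod q l * g_inf (q\<^sup>2))\<bar> < \<epsilon>"
proof -
  obtain M where M: "\<And>j m. M \<le> j \<Longrightarrow> M \<le> m \<Longrightarrow>
    \<bar>real (card (SHull (m + l + j) (2 * j + l) l :: 'a vec set set)) /
        gauss_binomial q (2 * (m + l + j)) (2 * j + l)
      - q ^ l * g_inf q / (h_prod q l * g_inf (q\<^sup>2))\<bar> < \<epsilon>"
    using tendstoD[OF SHull_ratio_tendsto[where 'a = 'a and l = l] assms(2)]
    unfolding eventually_prod_sequentially q_def by (auto simp: dist_real_def)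
  show ?thesis
  proof (rule that)
    fix n j :: nat assume "M \<le> j" "M + l + j \<le> n"
    then show "\<bar>real (card (SHull n (2 * j + l) l :: 'a vec set set)) / gauss_binomial q (2 * n) (2 * j + l)
      - q ^ l * g_inf q / (h_prod q l * g_inf (q\<^sup>2))\<bar> < \<epsilon>"
      \<comment> \<open>The remaining parameter is recovered as \<open>m = n - l - j\<close>, which
        is at least \<open>M\<close>.\<close>
      using M[of j "n - l - j"] by (simp add: algebra_simps)
  qed
qed

theorem theorem4p13:
  fixes q l :: nat
  assumes "primepow q"
    and "card (UNIV :: 'a :: {field, finite} set) = q"
  shows
    "(\<forall>\<epsilon>>0. \<exists>M. \<forall>n k.
        l \<le> k \<and> k \<le> 2 * n \<and> (\<exists>k0. k = 2 * k0 + l) \<and> M \<le> k \<and> M \<le> 2 * n - k \<longrightarrow>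
        \<bar>real (card (SHull n k l :: 'a vec set set)) / gauss_binomial (real q) (2 * n) k
          - real q ^ l * g_inf (real q) / (h_prod (real q) l * g_inf ((real q)\<^sup>2))\<bar> < \<epsilon>)
   \<and> (\<forall>\<epsilon>>0. \<exists>M. \<forall>n k.
        k \<le> 2 * n \<and> (\<exists>k0. k = 2 * k0) \<and> M \<le> k \<and> M \<le> 2 * n - k \<longrightarrow>
        \<bar>real (card (SHull n k 0 :: 'a vec set set)) / gauss_binomial (real q) (2 * n) k
          - g_inf (real q) / g_inf ((real q)\<^sup>2)\<bar> < \<epsilon>)
   \<and> (\<forall>\<epsilon>>0. \<exists>M. \<forall>n k0.
        k0 \<le> n \<and> M \<le> k0 \<and> M \<le> n - k0 \<longrightarrow>
        \<bar>real (card (SLCD n (2 * k0) :: 'a vec set set)) / gauss_binomial (real q) (2 * n) (2 * k0)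
          - g_inf (real q) / g_inf ((real q)\<^sup>2)\<bar> < \<epsilon>)"
proof -
  have general: "\<forall>\<epsilon>>0. \<exists>M. \<forall>n k.
        l \<le> k \<and> k \<le> 2 * n \<and> (\<exists>k0. k = 2 * k0 + l) \<and> M \<le> k \<and> M \<le> 2 * n - k \<longrightarrow>
        \<bar>real (card (SHull n k l :: 'a vec set set)) / gauss_binomial (real q) (2 * n) k
          - real q ^ l * g_inf (real q) / (h_prod (real q) l * g_inf ((real q)\<^sup>2))\<bar> < \<epsilon>" for l
  proof (intro allI impI)
    fix \<epsilon> :: real assume "\<epsilon> > 0"
    then obtain M where M: "\<And>n j. M \<le> j \<Longrightarrow> M + l + j \<le> n \<Longrightarrow>
      \<bar>real (card (SHull n (2 * j + l) l :: 'a vec set set)) / gauss_binomial (real q) (2 * n) (2 * j + l)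
        - real q ^ l * g_inf (real q) / (h_prod (real q) l * g_inf ((real q)\<^sup>2))\<bar> < \<epsilon>"
      using SHull_ratio_limit[of \<epsilon> l, where 'a = 'a] assms(2) by metis
    show "\<exists>M. \<forall>n k.
        l \<le> k \<and> k \<le> 2 * n \<and> (\<exists>k0. k = 2 * k0 + l) \<and> M \<le> k \<and> M \<le> 2 * n - k \<longrightarrow>
        \<bar>real (card (SHull n k l :: 'a vec set set)) / gauss_binomial (real q) (2 * n) k
          - real q ^ l * g_inf (real q) / (h_prod (real q) l * g_inf ((real q)\<^sup>2))\<bar> < \<epsilon>"
    \<comment> \<open>With \<open>k = 2 * k0 + l\<close>, the bound on \<open>k\<close> gives
      \<open>M \<le> k0\<close>, and the bound on \<open>2 * n - k\<close> gives
      \<open>M + l + k0 \<le> n\<close>.\<close>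
    proof (intro exI[of _ "2 * M + 2 * l"] allI impI, elim conjE exE)
      fix n k k0 assume "k = 2 * k0 + l" "2 * M + 2 * l \<le> k" "2 * M + 2 * l \<le> 2 * n - k" "k \<le> 2 * n"
      then show "\<bar>real (card (SHull n k l :: 'a vec set set)) / gauss_binomial (real q) (2 * n) k
          - real q ^ l * g_inf (real q) / (h_prod (real q) l * g_inf ((real q)\<^sup>2))\<bar> < \<epsilon>"
        using M[of k0 n] by simp
    qed
  qed
  have lcd: "\<forall>\<epsilon>>0. \<exists>M. \<forall>n k0. k0 \<le> n \<and> M \<le> k0 \<and> M \<le> n - k0 \<longrightarrow>
        \<bar>real (card (SLCD n (2 * k0) :: 'a vec set set)) / gauss_binomial (real q) (2 * n) (2 * k0)
          - g_inf (real q) / g_inf ((real q)\<^sup>2)\<bar> < \<epsilon>"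
  proof (intro allI impI)
    fix \<epsilon> :: real assume "\<epsilon> > 0"
    then obtain M where M: "\<And>n j. M \<le> j \<Longrightarrow> M + j \<le> n \<Longrightarrow>
      \<bar>real (card (SLCD n (2 * j) :: 'a vec set set)) / gauss_binomial (real q) (2 * n) (2 * j)
        - g_inf (real q) / g_inf ((real q)\<^sup>2)\<bar> < \<epsilon>"
      using SHull_ratio_limit[of \<epsilon> 0, where 'a = 'a] assms(2)
      by (auto simp: SLCD_eq_SHull h_prod_def)
    show "\<exists>M. \<forall>n k0. k0 \<le> n \<and> M \<le> k0 \<and> M \<le> n - k0 \<longrightarrow>
        \<bar>real (card (SLCD n (2 * k0) :: 'a vec set set)) / gauss_binomial (real q) (2 * n) (2 * k0)
          - g_inf (real q) / g_inf ((real q)\<^sup>2)\<bar> < \<epsilon>"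
      using M by (intro exI[of _ M]) auto
  qed
  show ?thesis
    using general[of l] general[of 0] lcd by (simp add: h_prod_def)
qed

end
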